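(* Let $A$ be a finite alphabet. The antipode $S$ of the Hopf algebra of sentences over $A$ is given, for every sentence $I$, by $$S(I)=\sum_{J\preccurlyeq I^r}(-1)^{\ell(J)}J .$$
   Context: $\Bbbk$ is a field of characteristic zero. A word is a finite sequence of letters of $A$. A sentence $I=(w_1,\dots,w_m)$ is a finite sequence of non-empty words; the empty sentence is denoted by $1$. Its length is $\ell(I)=m$. Its reversal is $I^r=(w_m,w_{m-1},\dots,w_1)$ (the words themselves are not reversed). For sentences $I,J$, write $J\preccurlyeq I$ ($J$ is a refinement of $I$) if the words of $I$ can be obtained by concatenating adjacent words of $J$. The Hopf algebra of sentences is the $\Bbbk$-vector space with basis the sentences over $A$, with multiplication the concatenation $(w_1,\dots,w_m)\cdot(v_1,\dots,v_n)=(w_1,\dots,w_m,v_1,\dots,v_n)$, unit the empty sentence, counit $\epsilon(1)=1$ and $\epsilon(I)=0$ for $I\neq 1$, and comultiplication $\Delta(I)=\sum_{J\subset I}\widetilde{I\setminus J}\otimes\widetilde J$. Here $J=(v_1,\dots,v_m)\subset I=(w_1,\dots,w_m)$ runs over sequences of possibly empty words such that $w_i=u_iv_i$ for some words $u_i$; $I\setminus J=(u_1,\dots,u_m)$; and tilde means deleting the empty words. It is a bialgebra graded by $|I|$ (the total number of letters) and connected, hence a Hopf algebra. *)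

theory Defs
  imports "HOL-Library.Poly_Mapping" "HOL-Library.Sublist"
begin

text \<open>Sentences over \<open>A\<close>: finite sequences of non-empty words in the letters of \<open>A\<close>.\<close>

definition sentences :: "'a set \<Rightarrow> 'a list list set" where
  "sentences A = lists (lists A - {[]})"

text \<open>\<open>refines J I\<close> is \<open>J \<preceq> I\<close>: cutting \<open>J\<close> into non-empty consecutive blocks and
  concatenating the words in each block gives \<open>I\<close>.\<close>

definition refines :: "'a list list \<Rightarrow> 'a list list \<Rightarrow> bool" where
  "refines J I \<longleftrightarrow> (\<exists>Ks. [] \<notin> set Ks \<and> concat Ks = J \<and> map concat Ks = I)"

text \<open>Vectors are finitely supported functions on a basis, and the tensor product of the
  spaces with bases \<open>X\<close> and \<open>Y\<close> is the space with basis \<open>X \<times> Y\<close>.\<close>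

abbreviation basis :: "'b \<Rightarrow> 'b \<Rightarrow>\<^sub>0 'k::field_char_0" where
  "basis b \<equiv> Poly_Mapping.single b 1"

definition scale :: "'k::field_char_0 \<Rightarrow> ('b \<Rightarrow>\<^sub>0 'k) \<Rightarrow> ('b \<Rightarrow>\<^sub>0 'k)" where
  "scale c x = Poly_Mapping.map ((*) c) x"

definition linear_extension ::
    "('b \<Rightarrow> ('c \<Rightarrow>\<^sub>0 'k)) \<Rightarrow> ('b \<Rightarrow>\<^sub>0 'k::field_char_0) \<Rightarrow> ('c \<Rightarrow>\<^sub>0 'k)" where
  "linear_extension f x = (\<Sum>b\<in>Poly_Mapping.keys x. scale (Poly_Mapping.lookup x b) (f b))"

definition tensor ::
    "('b \<Rightarrow>\<^sub>0 'k) \<Rightarrow> ('c \<Rightarrow>\<^sub>0 'k::field_char_0) \<Rightarrow> ('b \<times> 'c \<Rightarrow>\<^sub>0 'k)" where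
  "tensor x y = (\<Sum>b\<in>Poly_Mapping.keys x. \<Sum>c\<in>Poly_Mapping.keys y.
     Poly_Mapping.single (b, c) (Poly_Mapping.lookup x b * Poly_Mapping.lookup y c))"

definition tensor_map ::
    "(('b \<Rightarrow>\<^sub>0 'k) \<Rightarrow> ('d \<Rightarrow>\<^sub>0 'k)) \<Rightarrow> (('c \<Rightarrow>\<^sub>0 'k) \<Rightarrow> ('e \<Rightarrow>\<^sub>0 'k))
      \<Rightarrow> ('b \<times> 'c \<Rightarrow>\<^sub>0 'k::field_char_0) \<Rightarrow> ('d \<times> 'e \<Rightarrow>\<^sub>0 'k)" where
  "tensor_map f g = linear_extension (\<lambda>(b, c). tensor (f (basis b)) (g (basis c)))"

text \<open>The underlying space of the Hopf algebra of sentences over \<open>A\<close>. The structure maps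
  below are given by formulas that do not mention \<open>A\<close>; they are used on this space only.\<close>

definition sentence_space :: "'a set \<Rightarrow> ('a list list \<Rightarrow>\<^sub>0 'k::field_char_0) set" where
  "sentence_space A = {x. Poly_Mapping.keys x \<subseteq> sentences A}"

definition sentence_mult ::
    "('a list list \<times> 'a list list \<Rightarrow>\<^sub>0 'k::field_char_0) \<Rightarrow> ('a list list \<Rightarrow>\<^sub>0 'k)" where
  "sentence_mult = linear_extension (\<lambda>(I, J). basis (I @ J))"

definition sentence_unit :: "'k::field_char_0 \<Rightarrow> ('a list list \<Rightarrow>\<^sub>0 'k)" where
  "sentence_unit c = scale c (basis [])"

definition sentence_counit :: "('a list list \<Rightarrow>\<^sub>0 'k::field_char_0) \<Rightarrow> 'k" where
  "sentence_counit x =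
     (\<Sum>I\<in>Poly_Mapping.keys x. Poly_Mapping.lookup x I * (if I = [] then 1 else 0))"

definition drop_empty_words :: "'a list list \<Rightarrow> 'a list list" where
  "drop_empty_words J = filter (\<lambda>w. w \<noteq> []) J"

text \<open>For \<open>J = (v\<^sub>1, \<dots>, v\<^sub>m)\<close> consisting of suffixes of the words of \<open>I = (w\<^sub>1, \<dots>, w\<^sub>m)\<close>,
  this is the sequence \<open>(u\<^sub>1, \<dots>, u\<^sub>m)\<close> with \<open>w\<^sub>i = u\<^sub>i v\<^sub>i\<close>.\<close>

definition sentence_minus :: "'a list list \<Rightarrow> 'a list list \<Rightarrow> 'a list list" where
  "sentence_minus I J = map2 (\<lambda>w v. take (length w - length v) w) I J"

definition sentence_comult ::
    "('a list list \<Rightarrow>\<^sub>0 'k::field_char_0) \<Rightarrow> ('a list list \<times> 'a list list \<Rightarrow>\<^sub>0 'k)" where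
  "sentence_comult = linear_extension (\<lambda>I. \<Sum>J | list_all2 suffix J I.
     basis (drop_empty_words (sentence_minus I J), drop_empty_words J))"

definition linear_on_sentences ::
    "'a set \<Rightarrow> (('a list list \<Rightarrow>\<^sub>0 'k::field_char_0) \<Rightarrow> ('a list list \<Rightarrow>\<^sub>0 'k)) \<Rightarrow> bool" where
  "linear_on_sentences A S \<longleftrightarrow>
     (\<forall>x\<in>sentence_space A. S x \<in> sentence_space A) \<and>
     (\<forall>x\<in>sentence_space A. \<forall>y\<in>sentence_space A. S (x + y) = S x + S y) \<and>
     (\<forall>c. \<forall>x\<in>sentence_space A. S (scale c x) = scale c (S x))"

text \<open>An antipode is a two-sided convolution inverse of the identity.\<close>

definition is_antipode ::
    "'a set \<Rightarrow> (('a list list \<Rightarrow>\<^sub>0 'k::field_char_0) \<Rightarrow> ('a list list \<Rightarrow>\<^sub>0 'k)) \<Rightarrow> bool" where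
  "is_antipode A S \<longleftrightarrow>
     linear_on_sentences A S \<and>
     (\<forall>x\<in>sentence_space A.
        sentence_mult (tensor_map S id (sentence_comult x)) = sentence_unit (sentence_counit x) \<and>
        sentence_mult (tensor_map id S (sentence_comult x)) = sentence_unit (sentence_counit x))"

end

theory Submission imports Defs "HOL.Modules" begin

text \<open>For a single word \<open>w\<close> let \<open>S w\<close> be the sum of \<open>(-1)\<^sup>k (u\<^sub>1, \<dots>, u\<^sub>k)\<close> over all
  factorisations of \<open>w\<close> into non-empty words. Singling out the first or the last factor shows
  that the sums of \<open>u \<cdot> S v\<close> and of \<open>S u \<cdot> v\<close> over \<open>w = u v\<close> vanish for \<open>w \<noteq> []\<close>. Extend \<open>S\<close>
  antimultiplicatively, \<open>S (w\<^sub>1, \<dots>, w\<^sub>m) = S w\<^sub>m \<cdots> S w\<^sub>1\<close>. In the left convolution of \<open>S\<close> with the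
  identity the factors belonging to the first word \<open>w\<^sub>1\<close> are adjacent and cancel; in the right
  convolution those of the last word are, which gives induction on \<open>m\<close>. Expanding the product
  gives the sum over the refinements of the reversed sentence. Uniqueness needs no
  coassociativity: the left convolution identity determines the values of an antipode by
  induction on the number of letters.\<close>

section \<open>Linear algebra of finitely supported functions\<close>

lemma lookup_scale [simp]:
  "Poly_Mapping.lookup (scale c x) b = c * Poly_Mapping.lookup x b"
  by (simp add: scale_def Poly_Mapping.map.rep_eq when_def)

lemma scale_single [simp]: "scale c (Poly_Mapping.single b d) = Poly_Mapping.single b (c * d)"
  by (intro poly_mapping_eqI) (simp add: lookup_single when_def)

text \<open>Provides the distributivity and sum laws for \<open>scale\<close>, and with them
  \<open>module_hom\<close> as the notion of linear map.\<close>

interpretation scale: module "scale :: 'k::field_char_0 \<Rightarrow> ('b \<Rightarrow>\<^sub>0 'k) \<Rightarrow> ('b \<Rightarrow>\<^sub>0 'k)"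
  by unfold_locales (auto intro!: poly_mapping_eqI simp: lookup_add algebra_simps)

abbreviation linear_map ::
    "(('b \<Rightarrow>\<^sub>0 'k) \<Rightarrow> ('c \<Rightarrow>\<^sub>0 'k::field_char_0)) \<Rightarrow> bool" where
  "linear_map \<equiv> module_hom scale scale"

lemma linear_mapI:
  assumes "\<And>x y. f (x + y) = f x + f y" "\<And>c x. f (scale c x) = scale c (f x)"
  shows "linear_map f"
  using assms by unfold_locales auto

text \<open>Indices outside the support have coefficient 0. This allows \<open>x\<close>,
  \<open>y\<close> and \<open>x + y\<close>, whose supports differ, to be expanded over one common
  index set.\<close>

lemma linear_extension_superset:
  assumes "finite B" "Poly_Mapping.keys x \<subseteq> B"
  shows "linear_extension f x = (\<Sum>b\<in>B. scale (Poly_Mapping.lookup x b) (f b))"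
  unfolding linear_extension_def
  by (rule sum.mono_neutral_left) (use assms in \<open>auto simp: in_keys_iff\<close>)

lemma linear_extension_linear:
  fixes f :: "'b \<Rightarrow> ('c \<Rightarrow>\<^sub>0 'k::field_char_0)"
  shows "linear_map (linear_extension f)"
proof (rule linear_mapI)
  fix x y :: "'b \<Rightarrow>\<^sub>0 'k"
  let ?B = "Poly_Mapping.keys x \<union> Poly_Mapping.keys y"
  have "linear_extension f z = (\<Sum>b\<in>?B. scale (Poly_Mapping.lookup z b) (f b))"
    if "z \<in> {x, y, x + y}" for z
    by (rule linear_extension_superset) (use that keys_add[of x y] in auto)
  then show "linear_extension f (x + y) = linear_extension f x + linear_extension f y"
    by (simp add: lookup_add scale.scale_left_distrib sum.distrib)
next
  fix c and x :: "'b \<Rightarrow>\<^sub>0 'k"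
  \<comment> \<open>The support of \<open>scale c x\<close> is empty for \<open>c = 0\<close>, so
    the expansion is taken over the support of \<open>x\<close>.\<close>
  have "linear_extension f (scale c x)
      = (\<Sum>b\<in>Poly_Mapping.keys x. scale (c * Poly_Mapping.lookup x b) (f b))"
    by (subst linear_extension_superset[of "Poly_Mapping.keys x"]) (auto simp: in_keys_iff)
  then show "linear_extension f (scale c x) = scale c (linear_extension f x)"
    by (simp add: linear_extension_def scale.scale_sum_right)
qed

lemma linear_extension_basis [simp]: "linear_extension f (basis b) = f b"
  by (simp add: linear_extension_def)

lemma linear_extension_cong:
  assumes "\<And>b. b \<in> Poly_Mapping.keys x \<Longrightarrow> f b = g b"
  shows "linear_extension f x = linear_extension g x"
  using assms by (simp add: linear_extension_def)

lemma linear_map_linear_extension: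
  assumes "linear_map g"
  shows "g (linear_extension f x) = linear_extension (\<lambda>b. g (f b)) x"
  by (simp add: linear_extension_def module_hom.sum[OF assms] module_hom.scale[OF assms])

lemma linear_extension_id: "linear_extension basis x = x"
  by (intro poly_mapping_eqI)
    (auto simp: linear_extension_def lookup_sum lookup_single when_def in_keys_iff sum.delta)

lemma linear_map_expand:
  assumes "linear_map g"
  shows "g x = linear_extension (\<lambda>b. g (basis b)) x"
  using linear_map_linear_extension[OF assms, of basis x] by (simp add: linear_extension_id)

lemma linear_map_eqI:
  assumes "linear_map f" "linear_map g" "\<And>b. f (basis b) = g (basis b)"
  shows "f x = g x"
  by (simp only: linear_map_expand[OF assms(1), of x] linear_map_expand[OF assms(2), of x] assms(3))

text \<open>Serves the linearity of \<open>conc\<close> in its second argument: for fixed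
  \<open>x\<close> the outer linear extension is a finite combination of linear maps.\<close>

lemma linear_map_sum_scale:
  assumes "\<And>i. i \<in> B \<Longrightarrow> linear_map (f i)"
  shows "linear_map (\<lambda>y. \<Sum>i\<in>B. scale (c i) (f i y))"
proof (rule linear_mapI)
  show "(\<Sum>i\<in>B. scale (c i) (f i (x + y))) = (\<Sum>i\<in>B. scale (c i) (f i x)) + (\<Sum>i\<in>B. scale (c i) (f i y))"
    for x y
    by (simp add: module_hom.add[OF assms] scale.scale_right_distrib flip: sum.distrib)
  show "(\<Sum>i\<in>B. scale (c i) (f i (scale d x))) = scale d (\<Sum>i\<in>B. scale (c i) (f i x))" for d x
    by (simp add: module_hom.scale[OF assms] scale.scale_sum_right mult.commute)
qed

lemma linear_map_comp:
  assumes "linear_map f" "linear_map g"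
  shows "linear_map (\<lambda>x. g (f x))"
  using assms by (intro linear_mapI) (simp_all add: module_hom.add module_hom.scale)

section \<open>The concatenation product\<close>

text \<open>The product of the free algebra as a bilinear operation on vectors, so that no tensors
  occur in calculations; \<open>sentence_mult_tensor\<close> gives the link.\<close>

definition conc :: "('a list \<Rightarrow>\<^sub>0 'k) \<Rightarrow> ('a list \<Rightarrow>\<^sub>0 'k) \<Rightarrow> ('a list \<Rightarrow>\<^sub>0 'k::field_char_0)"
    (infixl \<open>\<odot>\<close> 70) where
  "x \<odot> y = linear_extension (\<lambda>b. linear_extension (\<lambda>c. basis (b @ c)) y) x"

lemma conc_linear_left: "linear_map (\<lambda>x. x \<odot> y)"
  unfolding conc_def by (rule linear_extension_linear)

lemma conc_linear_right: "linear_map (\<lambda>y. x \<odot> y)"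
  unfolding conc_def linear_extension_def[of _ x]
  by (rule linear_map_sum_scale) (rule linear_extension_linear)

lemmas conc_sum_left = module_hom.sum[OF conc_linear_left]
lemmas conc_sum_right = module_hom.sum[OF conc_linear_right]
lemmas conc_zero_left [simp] = module_hom.zero[OF conc_linear_left]
lemmas conc_zero_right [simp] = module_hom.zero[OF conc_linear_right]
lemmas conc_scale_left = module_hom.scale[OF conc_linear_left]
lemmas conc_scale_right = module_hom.scale[OF conc_linear_right]

lemma conc_basis [simp]: "basis b \<odot> basis c = basis (b @ c)"
  by (simp add: conc_def)

lemma conc_one_left [simp]: "basis [] \<odot> x = x"
  by (simp add: conc_def linear_extension_id)

lemma conc_one_right [simp]: "x \<odot> basis [] = x"
  by (simp add: conc_def linear_extension_id)

text \<open>Both sides are linear in each argument, so \<open>z\<close>, then \<open>y\<close>, then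
  \<open>x\<close> is reduced to basis vectors, where associativity of append applies.\<close>

lemma conc_assoc: "(x \<odot> y) \<odot> z = x \<odot> (y \<odot> z)"
proof -
  have 1: "(basis a \<odot> basis b) \<odot> z = basis a \<odot> (basis b \<odot> z)" for a b
    by (rule linear_map_eqI[of "\<lambda>z. (basis a \<odot> basis b) \<odot> z" "\<lambda>z. basis a \<odot> (basis b \<odot> z)"])
      (auto intro: conc_linear_right linear_map_comp[OF conc_linear_right conc_linear_right])
  have 2: "(basis a \<odot> y) \<odot> z = basis a \<odot> (y \<odot> z)" for a
    by (rule linear_map_eqI[of "\<lambda>y. (basis a \<odot> y) \<odot> z" "\<lambda>y. basis a \<odot> (y \<odot> z)"])
      (use 1 in \<open>auto intro: linear_map_comp[OF conc_linear_right conc_linear_left]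
         linear_map_comp[OF conc_linear_left conc_linear_right]\<close>)
  show ?thesis
    by (rule linear_map_eqI[of "\<lambda>x. (x \<odot> y) \<odot> z" "\<lambda>x. x \<odot> (y \<odot> z)"])
      (use 2 in \<open>auto intro: linear_map_comp[OF conc_linear_left conc_linear_left]
         conc_linear_left\<close>)
qed

lemma sentence_mult_linear: "linear_map sentence_mult"
  unfolding sentence_mult_def by (rule linear_extension_linear)

lemma sentence_mult_tensor: "sentence_mult (tensor x y) = x \<odot> y"
proof -
  have "sentence_mult (Poly_Mapping.single (b, c) d) = scale d (basis (b @ c))"
    for b c :: "'a list list" and d :: 'b
    using module_hom.scale[OF sentence_mult_linear, of d "basis (b, c)"]
    by (simp add: sentence_mult_def)
  then show ?thesis
    by (simp add: tensor_def module_hom.sum[OF sentence_mult_linear] conc_def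
        linear_extension_def scale.scale_sum_right)
qed

section \<open>Convolution\<close>

definition splits :: "'a list list \<Rightarrow> 'a list list set" where
  "splits I = {J. list_all2 suffix J I}"

lemma splits_Nil [simp]: "splits [] = {[]}"
  by (auto simp: splits_def)

lemma splits_Cons: "splits (w # I) = (\<lambda>(v, J). v # J) ` ({v. suffix v w} \<times> splits I)"
  by (auto simp: splits_def list_all2_Cons2)

lemma finite_suffixes: "finite {v. suffix v w}"
  by (metis List.finite_set Collect_mem_eq in_set_suffixes Collect_cong)

lemma finite_splits [simp]: "finite (splits I)"
  by (induction I) (auto simp: splits_Cons finite_suffixes)

text \<open>The suffix of the first word and the split of the remaining words are chosen
  independently.\<close>

lemma sum_splits_Cons:
  "(\<Sum>J\<in>splits (w # I). f J) = (\<Sum>v | suffix v w. \<Sum>J\<in>splits I. f (v # J))"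
  unfolding splits_Cons
  by (subst sum.reindex) (auto simp: inj_on_def sum.cartesian_product case_prod_unfold)

text \<open>A suffix \<open>v\<close> of \<open>w\<close> determines the complementary prefix, so
  suffixes correspond bijectively to factorisations \<open>u @ v = w\<close>.\<close>

lemma sum_suffix:
  "(\<Sum>v | suffix v w. f (take (length w - length v) w) v) = (\<Sum>(u, v) | u @ v = w. f u v)"
  by (rule sum.reindex_bij_witness[where i = snd and j = "\<lambda>v. (take (length w - length v) w, v)"])
    (auto simp: suffix_def)

lemma sentence_minus_Cons [simp]:
  "sentence_minus (w # I) (v # J) = take (length w - length v) w # sentence_minus I J"
  by (simp add: sentence_minus_def)

lemma sentence_minus_Nil [simp]: "sentence_minus [] J = []"
  by (simp add: sentence_minus_def)

lemma drop_empty_words_simps [simp]: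
  "drop_empty_words [] = []"
  "drop_empty_words (w # I) = (if w = [] then drop_empty_words I else w # drop_empty_words I)"
  by (simp_all add: drop_empty_words_def)

text \<open>The convolution of \<open>f\<close> and \<open>g\<close> at a sentence.
  \<open>tensor_map\<close> evaluates \<open>f\<close> and \<open>g\<close> at basis vectors only,
  so both may be arbitrary functions.\<close>

lemma convolution_basis:
  "sentence_mult (tensor_map f g (sentence_comult (basis I))) =
     (\<Sum>J\<in>splits I. f (basis (drop_empty_words (sentence_minus I J))) \<odot> g (basis (drop_empty_words J)))"
  by (simp add: tensor_map_def sentence_comult_def splits_def[symmetric]
      module_hom.sum[OF linear_extension_linear] module_hom.sum[OF sentence_mult_linear]
      sentence_mult_tensor)

lemma convolution_linear: "linear_map (\<lambda>x. sentence_mult (tensor_map f g (sentence_comult x)))"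
  unfolding tensor_map_def sentence_comult_def
  by (intro linear_map_comp[OF linear_map_comp[OF linear_extension_linear linear_extension_linear]
        sentence_mult_linear])

lemma sentence_unit_counit_basis:
  "sentence_unit (sentence_counit (basis I)) = (if I = [] then basis [] else 0)"
  by (simp add: sentence_unit_def sentence_counit_def)

lemma sentence_unit_counit_linear:
  "linear_map (\<lambda>x :: 'b list list \<Rightarrow>\<^sub>0 'k. sentence_unit (sentence_counit x) :: 'b list list \<Rightarrow>\<^sub>0 'k::field_char_0)"
proof -
  have "(sentence_unit (sentence_counit x) :: 'b list list \<Rightarrow>\<^sub>0 'k) =
      linear_extension (\<lambda>I. sentence_unit (if I = [] then 1 else 0)) x"
    for x :: "'b list list \<Rightarrow>\<^sub>0 'k"
    by (simp add: sentence_unit_def sentence_counit_def linear_extension_def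
        scale.scale_sum_left del: scale_single)
  then show ?thesis by (simp add: linear_extension_linear)
qed

section \<open>The antipode\<close>

text \<open>For a non-empty word \<open>w\<close> these are the refinements of the one-word sentence
  \<open>[w]\<close>; the empty word has the empty composition alone.\<close>

definition compositions :: "'a list \<Rightarrow> 'a list list set" where
  "compositions w = {J. [] \<notin> set J \<and> concat J = w}"

definition signed_sum :: "'a list set \<Rightarrow> ('a list \<Rightarrow>\<^sub>0 'k::field_char_0)" where
  "signed_sum X = (\<Sum>J\<in>X. scale ((-1) ^ length J) (basis J))"

definition word_antipode :: "'a list \<Rightarrow> ('a list list \<Rightarrow>\<^sub>0 'k::field_char_0)" where
  "word_antipode w = signed_sum (compositions w)"

text \<open>The value at a basis sentence. The factor of the first word comes last, as an antipode
  reverses products; an empty word contributes the unit.\<close>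

primrec antipode :: "'a list list \<Rightarrow> ('a list list \<Rightarrow>\<^sub>0 'k::field_char_0)" where
  "antipode [] = basis []"
| "antipode (w # I) = antipode I \<odot> word_antipode w"

text \<open>Sends the empty word to the unit, which absorbs the deletion of empty words into the
  product.\<close>

definition word_basis :: "'a list \<Rightarrow> ('a list list \<Rightarrow>\<^sub>0 'k::field_char_0)" where
  "word_basis w = (if w = [] then basis [] else basis [w])"

lemma compositions_Nil: "compositions [] = {[]}"
proof -
  have "J = []" if "[] \<notin> set J" "concat J = []" for J :: "'b list list"
    using that by (cases J) auto
  then show ?thesis by (auto simp: compositions_def)
qed

text \<open>A composition of a non-empty word has a first factor \<open>u\<close>; the other factors
  compose the rest \<open>v\<close>.\<close>

lemma compositions_Cons:
  "w \<noteq> [] \<Longrightarrow> compositions w =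
     (\<lambda>((u, v), K). u # K) ` (SIGMA (u, v):{(u, v). u @ v = w \<and> u \<noteq> []}. compositions v)"
proof (intro set_eqI iffI)
  fix J assume "w \<noteq> []" "J \<in> compositions w"
  then show "J \<in> (\<lambda>((u, v), K). u # K) ` (SIGMA (u, v):{(u, v). u @ v = w \<and> u \<noteq> []}. compositions v)"
    by (cases J) (force simp: compositions_def image_iff)+
qed (auto simp: compositions_def)

lemma compositions_snoc:
  "w \<noteq> [] \<Longrightarrow> compositions w =
     (\<lambda>((u, v), K). K @ [v]) ` (SIGMA (u, v):{(u, v). u @ v = w \<and> v \<noteq> []}. compositions u)"
proof (intro set_eqI iffI)
  fix J assume "w \<noteq> []" "J \<in> compositions w"
  then show "J \<in> (\<lambda>((u, v), K). K @ [v]) ` (SIGMA (u, v):{(u, v). u @ v = w \<and> v \<noteq> []}. compositions u)"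
    by (cases J rule: rev_cases) (force simp: compositions_def image_iff)+
qed (auto simp: compositions_def)

lemma finite_factorisations: "finite {(u, v). u @ v = w \<and> P u v}"
proof (rule finite_subset)
  show "{(u, v). u @ v = w \<and> P u v} \<subseteq> set (prefixes w) \<times> set (suffixes w)"
    by (auto simp: suffix_def)
qed simp

lemma finite_compositions: "finite (compositions w)"
proof (induction w rule: length_induct)
  case (1 w)
  show ?case
  proof (cases "w = []")
    case False
    have "finite (SIGMA (u, v):{(u, v). u @ v = w \<and> u \<noteq> []}. compositions v)"
      using 1 by (intro finite_SigmaI finite_factorisations) auto
    then show ?thesis by (simp add: compositions_Cons[OF False])
  qed (simp add: compositions_Nil)
qed

lemma word_antipode_Nil [simp]: "word_antipode [] = basis []"
  by (simp add: word_antipode_def signed_sum_def compositions_Nil)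

section \<open>Cancellation for a single word\<close>

lemma sum_scale_sign:
  "(\<Sum>i\<in>X. scale ((-1) ^ Suc (n i)) (basis (f i))) = - (\<Sum>i\<in>X. scale ((-1) ^ n i) (basis (f i)))"
  by (simp add: single_uminus sum_negf)

text \<open>Compositions are grouped by their last factor \<open>v\<close>. Removing it leaves a
  composition of \<open>u\<close> with one factor fewer, whence the sign.\<close>

lemma word_antipode_left:
  assumes "w \<noteq> []"
  shows "(word_antipode w :: 'a list list \<Rightarrow>\<^sub>0 'k::field_char_0) = - (\<Sum>(u, v) | u @ v = w \<and> v \<noteq> []. word_antipode u \<odot> word_basis v)"
proof -
  let ?P = "{(u, v). u @ v = w \<and> v \<noteq> []}"
  have "(word_antipode w :: 'a list list \<Rightarrow>\<^sub>0 'k::field_char_0) =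
      (\<Sum>((u, v), K)\<in>(SIGMA (u, v):?P. compositions u). scale ((-1) ^ Suc (length K)) (basis (K @ [v])))"
    unfolding word_antipode_def signed_sum_def compositions_snoc[OF assms]
    by (subst sum.reindex) (auto simp: inj_on_def case_prod_unfold)
  also have "\<dots> = (\<Sum>(u, v)\<in>?P. \<Sum>K\<in>compositions u. scale ((-1) ^ Suc (length K)) (basis (K @ [v])))"
    by (subst sum.Sigma[symmetric])
      (auto intro!: sum.cong simp: finite_factorisations finite_compositions simp del: scale_single)
  also have "\<dots> = - (\<Sum>(u, v)\<in>?P. word_antipode u \<odot> word_basis v)"
    unfolding sum_scale_sign case_prod_unfold sum_negf
    by (intro arg_cong[of _ _ uminus] sum.cong)
      (auto simp: word_antipode_def signed_sum_def conc_sum_left conc_scale_left word_basis_def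
        simp del: scale_single)
  finally show ?thesis .
qed

text \<open>The mirror image: compositions are grouped by their first factor
  \<open>u\<close>.\<close>

lemma word_antipode_right:
  assumes "w \<noteq> []"
  shows "(word_antipode w :: 'a list list \<Rightarrow>\<^sub>0 'k::field_char_0) = - (\<Sum>(u, v) | u @ v = w \<and> u \<noteq> []. word_basis u \<odot> word_antipode v)"
proof -
  let ?P = "{(u, v). u @ v = w \<and> u \<noteq> []}"
  have "(word_antipode w :: 'a list list \<Rightarrow>\<^sub>0 'k::field_char_0) =
      (\<Sum>((u, v), K)\<in>(SIGMA (u, v):?P. compositions v). scale ((-1) ^ Suc (length K)) (basis (u # K)))"
    unfolding word_antipode_def signed_sum_def compositions_Cons[OF assms]
    by (subst sum.reindex) (auto simp: inj_on_def case_prod_unfold)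
  also have "\<dots> = (\<Sum>(u, v)\<in>?P. \<Sum>K\<in>compositions v. scale ((-1) ^ Suc (length K)) (basis (u # K)))"
    by (subst sum.Sigma[symmetric])
      (auto intro!: sum.cong simp: finite_factorisations finite_compositions simp del: scale_single)
  also have "\<dots> = - (\<Sum>(u, v)\<in>?P. word_basis u \<odot> word_antipode v)"
    unfolding sum_scale_sign case_prod_unfold sum_negf
    by (intro arg_cong[of _ _ uminus] sum.cong)
      (auto simp: word_antipode_def signed_sum_def conc_sum_right conc_scale_right word_basis_def
        simp del: scale_single)
  finally show ?thesis .
qed

text \<open>The factorisation with \<open>v = []\<close> contributes \<open>word_antipode w\<close>,
  which cancels all other terms by the recursion on the last factor.\<close>

lemma word_convolution_left:
  assumes "w \<noteq> []"
  shows "(\<Sum>(u, v) | u @ v = w. word_antipode u \<odot> word_basis v) = (0 :: 'a list list \<Rightarrow>\<^sub>0 'k::field_char_0)"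
proof -
  have eq: "{(u, v). u @ v = w} = insert (w, []) {(u, v). u @ v = w \<and> v \<noteq> []}"
    by auto
  show ?thesis
    unfolding eq using word_antipode_left[OF assms]
    by (subst sum.insert) (auto simp: finite_factorisations word_basis_def eq_neg_iff_add_eq_0)
qed

lemma word_convolution_right:
  assumes "w \<noteq> []"
  shows "(\<Sum>(u, v) | u @ v = w. word_basis u \<odot> word_antipode v) = (0 :: 'a list list \<Rightarrow>\<^sub>0 'k::field_char_0)"
proof -
  have eq: "{(u, v). u @ v = w} = insert ([], w) {(u, v). u @ v = w \<and> u \<noteq> []}"
    by auto
  show ?thesis
    unfolding eq using word_antipode_right[OF assms]
    by (subst sum.insert) (auto simp: finite_factorisations word_basis_def eq_neg_iff_add_eq_0)
qed

section \<open>Convolution inverses for sentences\<close>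

lemma antipode_drop_empty_words [simp]: "antipode (drop_empty_words I) = antipode I"
  by (induction I) simp_all

lemma basis_drop_empty_words_Cons:
  "basis (drop_empty_words (w # I)) = word_basis w \<odot> basis (drop_empty_words I)"
  by (simp add: word_basis_def)

text \<open>Order reversal puts the antipode of the prefix of the first word at the right end, next
  to the suffix of that word. No induction is required, as this pair alone sums to 0.\<close>

lemma antipode_left_inverse:
  assumes "[] \<notin> set I"
  shows "(\<Sum>J\<in>splits I. antipode (drop_empty_words (sentence_minus I J)) \<odot> basis (drop_empty_words J))
    = (if I = [] then basis [] else 0 :: 'a list list \<Rightarrow>\<^sub>0 'k::field_char_0)"
proof (cases I)
  case (Cons w I')
  with assms have "w \<noteq> []" by auto
  have "(\<Sum>J\<in>splits I. antipode (drop_empty_words (sentence_minus I J)) \<odot> basis (drop_empty_words J) :: 'a list list \<Rightarrow>\<^sub>0 'k::field_char_0)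
    = (\<Sum>v | suffix v w. \<Sum>J\<in>splits I'. antipode (sentence_minus I' J) \<odot>
        (word_antipode (take (length w - length v) w) \<odot> word_basis v) \<odot> basis (drop_empty_words J))"
    unfolding Cons sum_splits_Cons antipode_drop_empty_words basis_drop_empty_words_Cons
    by (simp add: conc_assoc)
  \<comment> \<open>For a fixed split \<open>J\<close> of the later words, the sum over
    \<open>v\<close> is pulled into the middle of the product.\<close>
  also have "\<dots> = (\<Sum>J\<in>splits I'. antipode (sentence_minus I' J) \<odot>
      (\<Sum>v | suffix v w. word_antipode (take (length w - length v) w) \<odot> word_basis v)
        \<odot> basis (drop_empty_words J))"
    by (subst sum.swap) (simp add: conc_sum_left conc_sum_right)
  also have "\<dots> = 0"
    using \<open>w \<noteq> []\<close>
    by (simp add: sum_suffix[of "\<lambda>u v. word_antipode u \<odot> word_basis v"] word_convolution_left Cons)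
  finally show ?thesis by (simp add: Cons)
qed simp

text \<open>Here the two factors of the first word are outermost and enclose the convolution of the
  tail, so the induction peels words off the front until the last word remains.\<close>

lemma antipode_right_inverse:
  assumes "[] \<notin> set I"
  shows "(\<Sum>J\<in>splits I. basis (drop_empty_words (sentence_minus I J)) \<odot> antipode (drop_empty_words J))
    = (if I = [] then basis [] else 0 :: 'a list list \<Rightarrow>\<^sub>0 'k::field_char_0)"
  using assms
proof (induction I)
  case (Cons w I)
  then have "w \<noteq> []" by auto
  have "(\<Sum>J\<in>splits (w # I). basis (drop_empty_words (sentence_minus (w # I) J)) \<odot> antipode (drop_empty_words J) :: 'a list list \<Rightarrow>\<^sub>0 'k::field_char_0)
    = (\<Sum>v | suffix v w. \<Sum>J\<in>splits I. word_basis (take (length w - length v) w) \<odot>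
        (basis (drop_empty_words (sentence_minus I J)) \<odot> antipode (drop_empty_words J)) \<odot>
        word_antipode v)"
    unfolding sum_splits_Cons antipode_drop_empty_words sentence_minus_Cons
      basis_drop_empty_words_Cons
    by (simp add: conc_assoc del: conc_basis)
  also have "\<dots> = (\<Sum>v | suffix v w. word_basis (take (length w - length v) w) \<odot>
        (\<Sum>J\<in>splits I. basis (drop_empty_words (sentence_minus I J)) \<odot> antipode (drop_empty_words J)) \<odot>
        word_antipode v)"
    by (simp add: conc_sum_left conc_sum_right)
  also have "\<dots> = (\<Sum>v | suffix v w. word_basis (take (length w - length v) w) \<odot>
        (if I = [] then basis [] else 0) \<odot> word_antipode v)"
    using Cons by (simp del: antipode_drop_empty_words)
  \<comment> \<open>For \<open>I\<close> non-empty the middle factor is 0; for \<open>I = []\<close>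
    it is the unit and the identity for the single word \<open>w\<close> applies.\<close>
  also have "\<dots> = 0"
    using \<open>w \<noteq> []\<close>
    by (simp add: sum_suffix[of "\<lambda>u v. word_basis u \<odot> word_antipode v"] word_convolution_right)
  finally show ?case by simp
qed simp

section \<open>Refinements\<close>

text \<open>\<open>refines\<close> forbids empty blocks but allows empty words inside a block; these
  are excluded here. The alphabet enters later, in \<open>sentence_refinements\<close>.\<close>

definition refinements :: "'a list list \<Rightarrow> 'a list list set" where
  "refinements I = {J. [] \<notin> set J \<and> refines J I}"

lemma refines_concat: "refines J I \<Longrightarrow> concat J = concat I"
proof -
  have "concat (concat Ks) = concat (map concat Ks)" for Ks :: "'b list list list"
    by (induction Ks) auto
  then show "refines J I \<Longrightarrow> concat J = concat I"
    by (auto simp: refines_def)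
qed

lemma refinements_Nil: "refinements [] = {[]}"
  by (auto simp: refinements_def refines_def)

text \<open>The last block of a refinement is a composition of the last word \<open>w\<close>, and
  the earlier blocks refine \<open>I\<close>.\<close>

lemma refinements_snoc:
  assumes "w \<noteq> []"
  shows "refinements (I @ [w]) = (\<lambda>(J, K). J @ K) ` (refinements I \<times> compositions w)"
proof (intro set_eqI iffI)
  fix J assume "J \<in> refinements (I @ [w])"
  then obtain Ks where Ks: "[] \<notin> set Ks" "concat Ks = J" "map concat Ks = I @ [w]" "[] \<notin> set J"
    by (auto simp: refinements_def refines_def)
  then obtain Ls K where "Ks = Ls @ [K]" "map concat Ls = I" "concat K = w"
    by (auto simp: map_eq_append_conv)
  with Ks show "J \<in> (\<lambda>(J, K). J @ K) ` (refinements I \<times> compositions w)"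
    by (intro image_eqI[of _ _ "(concat Ls, K)"])
      (auto simp: refinements_def refines_def compositions_def)
next
  fix J assume "J \<in> (\<lambda>(J, K). J @ K) ` (refinements I \<times> compositions w)"
  then obtain Ks K where "J = concat Ks @ K" "[] \<notin> set Ks" "map concat Ks = I"
    "[] \<notin> set (concat Ks)" "[] \<notin> set K" "concat K = w"
    by (auto simp: refinements_def refines_def compositions_def)
  \<comment> \<open>Since \<open>concat K = w\<close> is non-empty, \<open>K\<close> is a legitimate
    non-empty block.\<close>
  with assms show "J \<in> refinements (I @ [w])"
    unfolding refinements_def refines_def
    by (auto intro!: exI[of _ "Ks @ [K]"])
qed

text \<open>Two cut points of the same list would differ by a segment of non-empty words without
  letters, which must be empty.\<close>

lemma append_eq_concat_eq:
  assumes "J @ K = J' @ K'" "concat K = concat K'" "[] \<notin> set J" "[] \<notin> set J'"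
    "[] \<notin> set K" "[] \<notin> set K'"
  shows "J = J' \<and> K = K'"
proof -
  have "us = []" if "concat us = []" "[] \<notin> set us" for us :: "'a list list"
    using that by (cases us) auto
  with assms show ?thesis
    by (auto simp: append_eq_append_conv2)
qed

text \<open>A refinement splits uniquely into its part over \<open>I\<close> and its part over
  \<open>w\<close>; lengths add, so signs multiply.\<close>

lemma signed_sum_refinements_snoc:
  assumes "w \<noteq> []"
  shows "(signed_sum (refinements (I @ [w])) :: 'a list list \<Rightarrow>\<^sub>0 'k::field_char_0) = signed_sum (refinements I) \<odot> word_antipode w"
proof -
  have "inj_on (\<lambda>(J, K). J @ K) (refinements I \<times> compositions w)"
    by (auto simp: inj_on_def refinements_def compositions_def dest!: append_eq_concat_eq)
  then have "(signed_sum (refinements (I @ [w])) :: 'a list list \<Rightarrow>\<^sub>0 'k::field_char_0) = (\<Sum>J\<in>refinements I. \<Sum>K\<in>compositions w.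
      scale ((-1) ^ length J) (basis J) \<odot> scale ((-1) ^ length K) (basis K))"
    unfolding signed_sum_def refinements_snoc[OF assms]
    by (subst sum.reindex)
      (auto simp: sum.cartesian_product case_prod_unfold power_add conc_scale_left conc_scale_right
        mult.commute simp del: scale_single)
  then show ?thesis
    unfolding signed_sum_def word_antipode_def
    by (simp only: conc_sum_left) (simp only: conc_sum_right)
qed

text \<open>Both sides satisfy the same recursion: \<open>rev (w # I)\<close> ends in
  \<open>w\<close>, and \<open>antipode (w # I)\<close> has the factor of \<open>w\<close> on the
  right.\<close>

lemma antipode_eq_signed_sum:
  "[] \<notin> set I \<Longrightarrow> antipode I = signed_sum (refinements (rev I))"
proof (induction I)
  case Nil
  then show ?case by (simp add: refinements_Nil signed_sum_def)
next
  case (Cons w I)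
  then have "w \<noteq> []" by auto
  with Cons show ?case by (simp add: signed_sum_refinements_snoc)
qed

lemma sentences_iff: "I \<in> sentences A \<longleftrightarrow> [] \<notin> set I \<and> set (concat I) \<subseteq> A"
  by (auto simp: sentences_def in_lists_conv_set)

text \<open>A refinement has the same letters as the original sentence, hence stays over
  \<open>A\<close>.\<close>

lemma sentence_refinements:
  assumes "I \<in> sentences A"
  shows "refinements (rev I) = {J. J \<in> sentences A \<and> refines J (rev I)}"
proof -
  have "J \<in> sentences A" if "[] \<notin> set J" "refines J (rev I)" for J
  proof -
    have "set (concat J) = set (concat I)"
      unfolding refines_concat[OF that(2)] by simp
    with assms that(1) show ?thesis unfolding sentences_iff by simp
  qed
  then show ?thesis by (auto simp: refinements_def sentences_iff)
qed

section \<open>Existence and uniqueness\<close>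

lemma sentence_space_scale: "x \<in> sentence_space A \<Longrightarrow> scale c x \<in> sentence_space A"
  by (auto simp: sentence_space_def in_keys_iff)

lemma sentence_space_sum:
  "(\<And>i. i \<in> X \<Longrightarrow> f i \<in> sentence_space A) \<Longrightarrow> sum f X \<in> sentence_space A"
  unfolding sentence_space_def using keys_sum[of f X] by fastforce

lemma basis_in_sentence_space: "I \<in> sentences A \<Longrightarrow> basis I \<in> sentence_space A"
  by (simp add: sentence_space_def)

lemma antipode_in_sentence_space:
  assumes "I \<in> sentences A"
  shows "(antipode I :: 'a list list \<Rightarrow>\<^sub>0 'k::field_char_0) \<in> sentence_space A"
proof -
  have "[] \<notin> set I" using assms by (simp add: sentences_iff)
  then show ?thesis
    by (auto simp: antipode_eq_signed_sum signed_sum_def sentence_refinements[OF assms]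
        simp del: scale_single
        intro!: sentence_space_sum sentence_space_scale basis_in_sentence_space)
qed

lemma is_antipode_antipode: 
  "is_antipode A (linear_extension antipode :: ('a list list \<Rightarrow>\<^sub>0 'k::field_char_0) \<Rightarrow> _)"
proof -
  let ?S = "linear_extension antipode :: ('a list list \<Rightarrow>\<^sub>0 'k) \<Rightarrow> _"
  note lin = linear_extension_linear[of "antipode :: _ \<Rightarrow> 'a list list \<Rightarrow>\<^sub>0 'k"]
  have "?S x \<in> sentence_space A" if "x \<in> sentence_space A" for x
    using that unfolding linear_extension_def
    by (intro sentence_space_sum sentence_space_scale antipode_in_sentence_space)
      (auto simp: sentence_space_def)
  then have "linear_on_sentences A ?S"
    by (simp add: linear_on_sentences_def module_hom.add[OF lin] module_hom.scale[OF lin])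
  \<comment> \<open>The pair \<open>(f, g)\<close> covers the left and the right identity at once.
    Both sides are linear in \<open>x\<close>, whose support lies in \<open>sentences A\<close>, so
    basis sentences suffice.\<close>
  moreover have "sentence_mult (tensor_map f g (sentence_comult x)) = sentence_unit (sentence_counit x)"
    if "x \<in> sentence_space A" and fg: "(f, g) \<in> {(?S, id), (id, ?S)}" for x f g
  proof -
    have "sentence_mult (tensor_map f g (sentence_comult (basis I))) =
        sentence_unit (sentence_counit (basis I))" if "I \<in> sentences A" for I
      using fg that antipode_left_inverse[of I] antipode_right_inverse[of I]
      unfolding convolution_basis sentence_unit_counit_basis sentences_iff
      by (auto simp del: antipode_drop_empty_words)
    then have "linear_extension (\<lambda>I. sentence_mult (tensor_map f g (sentence_comult (basis I)))) x =
        linear_extension (\<lambda>I. sentence_unit (sentence_counit (basis I))) x"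
      using that(1) by (intro linear_extension_cong) (auto simp: sentence_space_def)
    then show ?thesis
      using linear_map_expand[OF convolution_linear, of f g x]
        linear_map_expand[OF sentence_unit_counit_linear, of x] by (simp only:)
  qed
  ultimately show ?thesis by (simp add: is_antipode_def)
qed

section \<open>Uniqueness by induction on the number of letters\<close>

lemma empty_split: "map (\<lambda>_. []) I \<in> splits I"
  by (induction I) (auto simp: splits_Cons)

lemma drop_empty_words_empty_split:
  "drop_empty_words (map (\<lambda>_. []) I) = []"
  by (induction I) auto

lemma sentence_minus_empty_split: "sentence_minus I (map (\<lambda>_. []) I) = I"
  by (induction I) auto

lemma concat_drop_empty_words [simp]: "concat (drop_empty_words I) = concat I"
  by (induction I) auto

lemma set_concat_sentence_minus: "J \<in> splits I \<Longrightarrow> set (concat (sentence_minus I J)) \<subseteq> set (concat I)"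
proof (induction I arbitrary: J)
  case (Cons w I)
  then obtain v K where "J = v # K" "K \<in> splits I" by (auto simp: splits_Cons)
  with Cons.IH[of K] set_take_subset[of "length w - length v" w] show ?case by auto
qed simp

text \<open>The letters of \<open>I\<close> are distributed between prefixes and suffixes; the
  induction measure drops once some suffix is non-empty.\<close>

lemma length_concat_sentence_minus:
  "J \<in> splits I \<Longrightarrow> length (concat (sentence_minus I J)) + length (concat J) = length (concat I)"
proof (induction I arbitrary: J)
  case (Cons w I)
  then show ?case by (force simp: splits_Cons dest: suffix_length_le)
qed simp

lemma splits_concat_Nil: "J \<in> splits I \<Longrightarrow> concat J = [] \<Longrightarrow> J = map (\<lambda>_. []) I"
  by (induction I arbitrary: J) (auto simp: splits_Cons)

text \<open>The split of \<open>I\<close> with only empty suffixes contributes \<open>S I\<close> to the left convolution, and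
  every other split only involves values of \<open>S\<close> on sentences with fewer letters.\<close>

lemma left_inverse_unique:
  assumes "\<And>I. I \<in> sentences A \<Longrightarrow>
      (\<Sum>J\<in>splits I. S (drop_empty_words (sentence_minus I J)) \<odot> basis (drop_empty_words J)) = e I"
    and "\<And>I. I \<in> sentences A \<Longrightarrow>
      (\<Sum>J\<in>splits I. T (drop_empty_words (sentence_minus I J)) \<odot> basis (drop_empty_words J)) = e I"
    and "I \<in> sentences A"
  shows "S I = T I"
  using assms(3)
proof (induction "length (concat I)" arbitrary: I rule: less_induct)
  case less
  let ?E = "map (\<lambda>_. []) I :: 'a list list"
  \<comment> \<open>Isolates the term of the all-empty split \<open>?E\<close>; a general
    \<open>U\<close> lets this serve both \<open>S\<close> and \<open>T\<close>.\<close>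
  have expand: "U I + (\<Sum>J\<in>splits I - {?E}. U (drop_empty_words (sentence_minus I J)) \<odot> basis (drop_empty_words J))
    = (\<Sum>J\<in>splits I. U (drop_empty_words (sentence_minus I J)) \<odot> basis (drop_empty_words J))"
    for U :: "'a list list \<Rightarrow> ('a list list \<Rightarrow>\<^sub>0 'b)"
  proof -
    have "drop_empty_words I = I"
      using less.prems by (auto simp: drop_empty_words_def sentences_iff filter_id_conv)
    then show ?thesis
      by (simp add: sum.remove[OF finite_splits empty_split] drop_empty_words_empty_split
          sentence_minus_empty_split)
  qed
  have "S (drop_empty_words (sentence_minus I J)) = T (drop_empty_words (sentence_minus I J))"
    if J: "J \<in> splits I - {?E}" for J
  proof (rule less.hyps)
    \<comment> \<open>\<open>?E\<close> is the only split whose suffixes contain no letter.\<close>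
    have "length (concat J) > 0"
      unfolding length_greater_0_conv using J splits_concat_Nil by blast
    then show "length (concat (drop_empty_words (sentence_minus I J))) < length (concat I)"
      using length_concat_sentence_minus[OF DiffD1[OF J]]
      unfolding concat_drop_empty_words by linarith
    have "[] \<notin> set (drop_empty_words (sentence_minus I J))"
      by (simp add: drop_empty_words_def)
    moreover have "set (concat (drop_empty_words (sentence_minus I J))) \<subseteq> A"
      using set_concat_sentence_minus[of J I] J less.prems
      unfolding concat_drop_empty_words sentences_iff by blast
    ultimately show "drop_empty_words (sentence_minus I J) \<in> sentences A"
      unfolding sentences_iff by blast
  qed
  then have "(\<Sum>J\<in>splits I - {?E}. S (drop_empty_words (sentence_minus I J)) \<odot> basis (drop_empty_words J))
    = (\<Sum>J\<in>splits I - {?E}. T (drop_empty_words (sentence_minus I J)) \<odot> basis (drop_empty_words J))"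
    by (intro sum.cong) auto
  moreover have "S I + (\<Sum>J\<in>splits I - {?E}. S (drop_empty_words (sentence_minus I J)) \<odot> basis (drop_empty_words J))
    = T I + (\<Sum>J\<in>splits I - {?E}. T (drop_empty_words (sentence_minus I J)) \<odot> basis (drop_empty_words J))"
    unfolding expand assms(1,2)[OF less.prems] ..
  ultimately show ?case by simp
qed

lemma is_antipode_unique:
  assumes "is_antipode A S" "I \<in> sentences A"
  shows "S (basis I) = antipode I"
proof (rule left_inverse_unique[where S = "\<lambda>I. S (basis I)" and T = antipode
      and e = "\<lambda>I. if I = [] then basis [] else 0", OF _ _ assms(2)])
  fix I assume I: "I \<in> sentences A"
  have "sentence_mult (tensor_map S id (sentence_comult (basis I))) =
      sentence_unit (sentence_counit (basis I))"
    using assms(1) basis_in_sentence_space[OF I] by (auto simp: is_antipode_def)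
  then show "(\<Sum>J\<in>splits I. S (basis (drop_empty_words (sentence_minus I J))) \<odot> basis (drop_empty_words J))
    = (if I = [] then basis [] else 0)"
    by (simp add: convolution_basis sentence_unit_counit_basis)
  show "(\<Sum>J\<in>splits I. antipode (drop_empty_words (sentence_minus I J)) \<odot> basis (drop_empty_words J))
    = (if I = [] then basis [] else 0)"
    using I by (intro antipode_left_inverse) (simp add: sentences_iff)
qed

theorem proposition3p7:
  fixes A :: "'a set"
  assumes "finite A"
  shows "(\<exists>S :: ('a list list \<Rightarrow>\<^sub>0 'k::field_char_0) \<Rightarrow> ('a list list \<Rightarrow>\<^sub>0 'k). is_antipode A S) \<and>
    (\<forall>S :: ('a list list \<Rightarrow>\<^sub>0 'k) \<Rightarrow> ('a list list \<Rightarrow>\<^sub>0 'k). is_antipode A S \<longrightarrow>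
      (\<forall>I\<in>sentences A. S (basis I) =
        (\<Sum>J | J \<in> sentences A \<and> refines J (rev I). scale ((-1) ^ length J) (basis J))))"
proof (intro conjI allI impI ballI)
  show "\<exists>S :: ('a list list \<Rightarrow>\<^sub>0 'k) \<Rightarrow> ('a list list \<Rightarrow>\<^sub>0 'k). is_antipode A S"
    using is_antipode_antipode by blast
next
  fix S :: "('a list list \<Rightarrow>\<^sub>0 'k) \<Rightarrow> ('a list list \<Rightarrow>\<^sub>0 'k)" and I
  assume "is_antipode A S" and I: "I \<in> sentences A"
  then have "S (basis I) = signed_sum (refinements (rev I))"
    by (simp add: is_antipode_unique antipode_eq_signed_sum sentences_iff)
  then show "S (basis I) = (\<Sum>J | J \<in> sentences A \<and> refines J (rev I). scale ((-1) ^ length J) (basis J))"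
    by (simp only: signed_sum_def sentence_refinements[OF I])
qed

end
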